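(* Let $\alpha<1$, $m(t)=t^\alpha$ and $b(t)=o(t^{1-\alpha})$. Then Maker wins the directed-Breaker game; that is, there exists $\varepsilon>0$ such that, in the directed-Breaker game with these $m,b$ and winning line segments of size $n$, $m(\tau_n)<(1-\varepsilon)n$ for all sufficiently large $n$.
   Context: Let $m,b\colon\mathbb{N}\to\mathbb{N}$ be monotone increasing. Two players, Maker and Breaker, play in timesteps $t=1,2,\dots$; in timestep $t$ Maker first claims $m(t)$ previously unclaimed points of $\mathbb{Z}^2$, then Breaker plays $b(t)$ points. In the directed-Breaker game, whenever Breaker plays a point he must also designate a direction, and that point only blocks Maker's potential winning segments on the line through that point in the designated direction (Breaker may play the same point with a different direction, but that counts as an additional point). A winning line segment is a set of $n$ points claimed by Maker lying on a common straight line $\ell$ with no Breaker point whose designated direction is that of $\ell$ lying on $\ell$ between the first and last of these $n$ points. $\tau_n$ is the earliest time by which Maker can guarantee to have formed a winning line segment of $n$ points. *)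

theory Defs
  imports Complex_Main "HOL-Library.Extended_Nat" "HOL-Library.Landau_Symbols"
begin

type_synonym point = "int \<times> int"

text \<open>Every direction of a line through two lattice points is represented by exactly one
  primitive vector, so that the lattice points of the line through \<open>p\<close> in direction \<open>d\<close> are
  \<open>line_point p d k\<close> for integers \<open>k\<close>, in order along the line.\<close>

definition directions :: "(int \<times> int) set" where
  "directions = {(u, v). coprime u v \<and> (u > 0 \<or> u = 0 \<and> v = 1)}"

definition line_point :: "point \<Rightarrow> int \<times> int \<Rightarrow> int \<Rightarrow> point" where
  "line_point p d k = (fst p + k * fst d, snd p + k * snd d)"

text \<open>A Breaker play is a point together with its designated direction.\<close>

type_synonym mark = "point \<times> (int \<times> int)"

text \<open>\<open>S\<close> is a set of \<open>n\<close> points of \<open>M\<close> on a line, with no mark of \<open>B\<close> in the direction of the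
  line from the first to the last of these points (inclusive).\<close>

definition winning_segment :: "nat \<Rightarrow> point set \<Rightarrow> mark set \<Rightarrow> point set \<Rightarrow> bool" where
  "winning_segment n M B S \<longleftrightarrow>
     S \<subseteq> M \<and> finite S \<and> card S = n \<and>
     (\<exists>p. \<exists>d\<in>directions. S \<subseteq> range (line_point p d) \<and>
        (\<forall>i j k. line_point p d i \<in> S \<and> line_point p d k \<in> S \<and> i \<le> j \<and> j \<le> k \<longrightarrow>
           (line_point p d j, d) \<notin> B))"

text \<open>A play of Breaker assigns to each timestep \<open>t \<ge> 1\<close> the set of marks he plays then.
  A mark does not prevent either player from using its point again.\<close>

definition breaker_play :: "(nat \<Rightarrow> nat) \<Rightarrow> (nat \<Rightarrow> mark set) \<Rightarrow> bool" where
  "breaker_play b \<beta> \<longleftrightarrow>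
     (\<forall>t\<ge>1. finite (\<beta> t) \<and> card (\<beta> t) = b t \<and> \<beta> t \<subseteq> UNIV \<times> directions)"

text \<open>A strategy of Maker maps the list of Breaker's earlier moves to the set of points
  claimed next; Maker's own earlier moves are determined by that list.\<close>

type_synonym maker_strategy = "mark set list \<Rightarrow> point set"

definition maker_move :: "maker_strategy \<Rightarrow> (nat \<Rightarrow> mark set) \<Rightarrow> nat \<Rightarrow> point set" where
  "maker_move \<sigma> \<beta> t = \<sigma> (map \<beta> [1..<t])"

definition legal_strategy ::
  "(nat \<Rightarrow> nat) \<Rightarrow> (nat \<Rightarrow> nat) \<Rightarrow> maker_strategy \<Rightarrow> bool" where
  "legal_strategy m b \<sigma> \<longleftrightarrow>
     (\<forall>\<beta>. breaker_play b \<beta> \<longrightarrow>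
        (\<forall>t\<ge>1. finite (maker_move \<sigma> \<beta> t) \<and> card (maker_move \<sigma> \<beta> t) = m t \<and>
           maker_move \<sigma> \<beta> t \<inter> (\<Union>s\<in>{1..<t}. maker_move \<sigma> \<beta> s) = {}))"

text \<open>Maker has formed a winning segment in timestep \<open>t\<close> if one is present after his move in
  that timestep, before Breaker replies.\<close>

definition forms_segment ::
  "nat \<Rightarrow> maker_strategy \<Rightarrow> (nat \<Rightarrow> mark set) \<Rightarrow> nat \<Rightarrow> bool" where
  "forms_segment n \<sigma> \<beta> t \<longleftrightarrow>
     (\<exists>S. winning_segment n (\<Union>s\<in>{1..t}. maker_move \<sigma> \<beta> s) (\<Union>s\<in>{1..<t}. \<beta> s) S)"

definition maker_guarantees ::
  "(nat \<Rightarrow> nat) \<Rightarrow> (nat \<Rightarrow> nat) \<Rightarrow> nat \<Rightarrow> nat \<Rightarrow> bool" where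
  "maker_guarantees m b n T \<longleftrightarrow>
     (\<exists>\<sigma>. legal_strategy m b \<sigma> \<and>
        (\<forall>\<beta>. breaker_play b \<beta> \<longrightarrow> (\<exists>t\<in>{1..T}. forms_segment n \<sigma> \<beta> t)))"

text \<open>The value is \<open>\<infinity>\<close> if Maker cannot guarantee a winning segment by any time.\<close>

definition tau :: "(nat \<Rightarrow> nat) \<Rightarrow> (nat \<Rightarrow> nat) \<Rightarrow> nat \<Rightarrow> enat" where
  "tau m b n = (INF T\<in>{T. maker_guarantees m b n T}. enat T)"

end

theory Submission
  imports Defs "HOL-Real_Asymp.Real_Asymp"
begin

text \<open>Maker need not react to Breaker: he fills a square grid of side about the square root of the
  number \<open>N\<close> of points available to him by time \<open>T\<close>. Such a grid contains of order \<open>N\<^sup>2 / n\<^sup>3\<close>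
  pairwise distinct lines with at least \<open>n\<close> points (the extremal configuration for the
  Szemeredi-Trotter theorem), and each mark of the directed Breaker spoils at most one of them.
  With \<open>N\<close> of order \<open>T\<^bsup>1+\<alpha>\<^esup>\<close> and \<open>n\<close> of order \<open>T\<^sup>\<alpha>\<close> this is of order \<open>T\<^bsup>2-\<alpha>\<^esup>\<close>, whereas Breaker has
  made only \<open>o(T\<^bsup>2-\<alpha>\<^esup>)\<close> marks.\<close>

section \<open>Counting coprime pairs\<close>

text \<open>The term \<open>g = 2\<close> contributes 1/4, and from \<open>g = 3\<close> on
  \<open>1/g^2\<close> is below \<open>1/(g - 1) - 1/g\<close>, which telescopes to at most 1/2.
  What matters later is that the bound is less than 1.\<close>

lemma sum_inverse_squares_le: "(\<Sum>g=2..n. 1 / (real g)\<^sup>2) \<le> 3/4"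
proof -
  have *: "(\<Sum>g=2..Suc (Suc k). 1 / (real g)\<^sup>2) \<le> 3/4 - 1 / real (k + 2)" for k :: nat
  proof (induction k)
    case 0
    then show ?case by simp
  next
    case (Suc k)
    have "1 / (real (k + 3))\<^sup>2 \<le> 1 / real (k + 2) - 1 / real (k + 3)"
      by (simp add: divide_simps power2_eq_square)
    then show ?case using Suc by (simp add: add_ac eval_nat_numeral)
  qed
  show ?thesis
  proof (cases "n \<ge> 2")
    case True
    then have "Suc (Suc (n - 2)) = n" by simp
    with *[of "n - 2"] have "(\<Sum>g=2..n. 1 / (real g)\<^sup>2) \<le> 3/4 - 1 / real (n - 2 + 2)" by simp
    also have "\<dots> \<le> 3/4" by simp
    finally show ?thesis .
  qed simp
qed

text \<open>A non-coprime pair with gcd \<open>g\<close> is \<open>g\<close> times a pair from the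
  square of side \<open>U div g\<close>, so there are at most \<open>U^2\<close> times the sum of
  \<open>1/g^2\<close> over \<open>g\<close> from 2 on. This leaves a quarter of all pairs.\<close>

lemma card_coprime_pairs_ge:
  fixes U :: nat
  defines "P \<equiv> {1..U} \<times> {1..U}"
  shows "real U ^ 2 / 4 \<le> real (card {(u, v) \<in> P. coprime u v})"
proof -
  define A where "A = {(u, v) \<in> P. coprime u v}"
  define C where "C = {(u, v) \<in> P. \<not> coprime u v}"
  have fin: "finite A" "finite C" by (auto simp: A_def C_def P_def intro: finite_subset[of _ P])
  have P: "P = A \<union> C" "A \<inter> C = {}" by (auto simp: A_def C_def)
  have "C \<subseteq> (\<Union>g\<in>{2..U}. (\<lambda>(a, b). (g * a, g * b)) ` ({1..U div g} \<times> {1..U div g}))"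
  proof clarify
    fix u v assume "(u, v) \<in> C"
    then have uv: "1 \<le> u" "u \<le> U" "1 \<le> v" "v \<le> U" "\<not> coprime u v"
      by (auto simp: C_def P_def)
    define g where "g = gcd u v"
    obtain a b where ab: "u = g * a" "v = g * b"
      by (metis dvdE g_def gcd_dvd1 gcd_dvd2)
    have "g \<noteq> 1" "g \<noteq> 0" using uv by (auto simp: g_def coprime_iff_gcd_eq_1)
    then have g: "g \<ge> 2" by simp
    have "g \<le> U" using uv ab \<open>g \<noteq> 0\<close>
      by (metis dvd_imp_le dvd_triv_left less_eq_Suc_le One_nat_def order_trans)
    moreover have "a \<in> {1..U div g}" "b \<in> {1..U div g}"
      using uv ab \<open>g \<noteq> 0\<close> by (auto simp: less_eq_div_iff_mult_less_eq mult.commute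
          intro: Suc_leI gr0I)
    ultimately show "(u, v) \<in> (\<Union>g\<in>{2..U}. (\<lambda>(a, b). (g * a, g * b)) `
        ({1..U div g} \<times> {1..U div g}))"
      using g ab by (intro UN_I[of g]) auto
  qed
  then have "card C \<le> card (\<Union>g\<in>{2..U}. (\<lambda>(a, b). (g * a, g * b)) `
      ({1..U div g} \<times> {1..U div g}))"
    by (intro card_mono) auto
  also have "\<dots> \<le> (\<Sum>g=2..U. card ((\<lambda>(a, b). (g * a, g * b)) `
      ({1..U div g} \<times> {1..U div g})))"
    by (intro card_UN_le) auto
  also have "\<dots> \<le> (\<Sum>g=2..U. (U div g) ^ 2)"
  proof (intro sum_mono)
    fix g
    show "card ((\<lambda>(a, b). (g * a, g * b)) ` ({1..U div g} \<times> {1..U div g})) \<le> (U div g) ^ 2"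
      by (rule order_trans[OF card_image_le]) (auto simp: power2_eq_square)
  qed
  finally have "real (card C) \<le> real (\<Sum>g=2..U. (U div g) ^ 2)" by (simp only: of_nat_le_iff)
  also have "\<dots> = (\<Sum>g=2..U. (real (U div g)) ^ 2)" by simp
  also have "\<dots> \<le> (\<Sum>g=2..U. real U ^ 2 * (1 / (real g)\<^sup>2))"
  proof (intro sum_mono)
    fix g
    have "(real (U div g)) ^ 2 \<le> (real U / real g) ^ 2"
      by (intro power_mono of_nat_div_le_of_nat) auto
    then show "(real (U div g)) ^ 2 \<le> real U ^ 2 * (1 / (real g)\<^sup>2)"
      by (simp add: power_divide)
  qed
  also have "\<dots> \<le> real U ^ 2 * (3/4)"
    unfolding sum_distrib_left[symmetric] by (intro mult_left_mono sum_inverse_squares_le) auto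
  finally have "real (card C) \<le> real U ^ 2 * (3/4)" .
  moreover have "real (card P) = real (card A) + real (card C)"
    using card_Un_disjoint[OF fin P(2)] P(1) by simp
  moreover have "real (card P) = real U ^ 2"
    by (simp add: P_def power2_eq_square)
  ultimately show ?thesis unfolding A_def by simp
qed

text \<open>The weight \<open>u\<close> is the number of residues modulo \<open>u\<close>, that is,
  of admissible first coordinates for lines of direction \<open>(u, v)\<close>. At most
  \<open>U^2/8\<close> pairs have \<open>u\<close> at most \<open>U/8\<close>, so at least
  \<open>U^2/8\<close> coprime pairs have weight above \<open>U/8\<close>.\<close>

lemma sum_coprime_pairs_ge:
  fixes U :: nat
  defines "P \<equiv> {1..U} \<times> {1..U}"
  shows "real U ^ 3 / 64 \<le> (\<Sum>(u, v)\<in>{(u, v) \<in> P. coprime u v}. real u)"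
proof -
  define A where "A = {(u, v) \<in> P. coprime u v}"
  define E where "E = {(u, v) \<in> A. 8 * u \<le> U}"
  have fin: "finite A" by (auto simp: A_def P_def intro: finite_subset[of _ P])
  have sub: "E \<subseteq> A" by (auto simp: E_def)
  have "E \<subseteq> {1..U div 8} \<times> {1..U}" by (auto simp: E_def A_def P_def)
  then have "card E \<le> (U div 8) * U"
    using card_mono[of "{1..U div 8} \<times> {1..U}" E] by simp
  then have "real (card E) \<le> real ((U div 8) * U)" by (simp only: of_nat_le_iff)
  also have "\<dots> \<le> real U / 8 * real U"
    unfolding of_nat_mult using of_nat_div_le_of_nat[of U 8, where ?'a = real]
    by (intro mult_right_mono) auto
  finally have E: "real (card E) \<le> real U ^ 2 / 8" by (simp add: power2_eq_square)
  have "real (card (A - E)) = real (card A) - real (card E)"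
    using card_Diff_subset[OF finite_subset[OF sub fin] sub] card_mono[OF fin sub] by simp
  then have "real U ^ 2 / 8 \<le> real (card (A - E))"
    using E card_coprime_pairs_ge[of U] by (simp add: A_def P_def)
  then have "real U ^ 2 / 8 * (real U / 8) \<le> real (card (A - E)) * (real U / 8)"
    by (intro mult_right_mono) auto
  also have "\<dots> = (\<Sum>x\<in>A - E. real U / 8)" by simp
  also have "\<dots> \<le> (\<Sum>x\<in>A - E. real (fst x))"
    by (intro sum_mono) (auto simp: E_def)
  also have "\<dots> \<le> (\<Sum>x\<in>A. real (fst x))"
    using fin by (intro sum_mono2) auto
  finally show ?thesis
    by (simp add: A_def case_prod_unfold power2_eq_square power3_eq_cube)
qed

section \<open>Rich lines in a square grid\<close>

text \<open>A line is encoded by a starting point and a primitive direction with positive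
  coordinates. The range of \<open>x\<close> selects one representative per residue class modulo
  \<open>u\<close>; the range of \<open>y\<close> leaves room for \<open>n\<close> steps of height
  at most \<open>U\<close> in a square of side \<open>2 * n * U\<close>.\<close>

definition grid_lines :: "nat \<Rightarrow> nat \<Rightarrow> (point \<times> (int \<times> int)) set" where
  "grid_lines n U = {((x, y), (u, v)). u \<in> {1..int U} \<and> v \<in> {1..int U} \<and> coprime u v \<and>
     x \<in> {0..<u} \<and> y \<in> {0..<int (n * U)}}"

lemma grid_lines_direction: "(p, d) \<in> grid_lines n U \<Longrightarrow> d \<in> directions"
  by (auto simp: grid_lines_def directions_def)

lemma line_point_inj:
  assumes "d \<in> directions" "line_point p d i = line_point p d j"
  shows "i = j"
  using assms by (auto simp: directions_def line_point_def)

text \<open>The starting points have their first coordinate in a complete residue system modulo \<open>u\<close>.\<close>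

lemma grid_lines_disjoint:
  assumes "(p, d) \<in> grid_lines n U" "(q, d) \<in> grid_lines n U"
    and eq: "line_point p d i = line_point q d j"
  shows "p = q"
proof -
  obtain x y x' y' u v where pq: "p = (x, y)" "q = (x', y')" "d = (u, v)"
    by (metis surj_pair)
  have *: "x \<in> {0..<u}" "x' \<in> {0..<u}" "x + i * u = x' + j * u" "y + i * v = y' + j * v"
    using assms by (auto simp: pq grid_lines_def line_point_def)
  have "(x + i * u) div u = i" "(x' + j * u) div u = j" using *(1,2) by auto
  with *(3) have "i = j" by simp
  with * show ?thesis by (simp add: pq)
qed

lemma grid_lines_in_grid:
  assumes "(p, d) \<in> grid_lines n U" "k < n"
  shows "line_point p d (int k) \<in> {0..<int (2 * n * U)} \<times> {0..<int (2 * n * U)}"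
proof -
  obtain x y u v where pd: "p = (x, y)" "d = (u, v)" by (metis surj_pair)
  have *: "1 \<le> u" "u \<le> int U" "1 \<le> v" "v \<le> int U" "0 \<le> x" "x < u" "0 \<le> y" "y < int (n * U)"
    using assms by (auto simp: pd grid_lines_def)
  \<comment> \<open>Since \<open>x < u\<close>, the offset \<open>x\<close> is absorbed by one
    further step of length \<open>u\<close>; this is why \<open>k + 1\<close> appears.\<close>
  have "int k * v \<le> int n * int U" "(int k + 1) * u \<le> int n * int U"
    using * assms(2) by (intro mult_mono; simp)+
  then have "y + int k * v < 2 * (int n * int U)" "x + int k * u < 2 * (int n * int U)"
    using * by (simp_all add: algebra_simps)
  then show ?thesis using * by (simp add: pd line_point_def)
qed

text \<open>Each coprime pair \<open>(u, v)\<close> admits \<open>u * (n * U)\<close> starting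
  points, so the weighted count of coprime pairs gets multiplied by \<open>n * U\<close>.\<close>

lemma card_grid_lines:
  "finite (grid_lines n U) \<and> real n * real U ^ 4 / 64 \<le> real (card (grid_lines n U))"
proof -
  define A where "A = {(u, v) \<in> {1..U} \<times> {1..U}. coprime u v}"
  define F where "F = (\<lambda>((u, v), (x, y)). ((int x, int y), (int u, int v)))"
  define D where "D = Sigma A (\<lambda>(u, v). {..<u} \<times> {..<n * U})"
  have fin: "finite A" by (auto simp: A_def intro: finite_subset[of _ "{1..U} \<times> {1..U}"])
  have "grid_lines n U = F ` D"
  proof (intro equalityI subsetI)
    fix l assume "l \<in> grid_lines n U"
    then obtain x y u v where l: "l = ((x, y), (u, v))"
      and *: "1 \<le> u" "u \<le> int U" "1 \<le> v" "v \<le> int U" "0 \<le> x" "x < u" "0 \<le> y"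
        "y < int (n * U)" "coprime u v"
      by (auto simp: grid_lines_def)
    have "l = F ((nat u, nat v), (nat x, nat y))" using * by (simp add: l F_def)
    moreover have "coprime (nat u) (nat v)"
      using * by (simp add: coprime_int_iff[symmetric])
    then have "((nat u, nat v), (nat x, nat y)) \<in> D"
      using * by (auto simp: D_def A_def nat_less_iff nat_le_iff)
    ultimately show "l \<in> F ` D" by blast
  next
    fix l assume "l \<in> F ` D"
    then show "l \<in> grid_lines n U"
      by (auto simp: F_def D_def A_def grid_lines_def simp flip: of_nat_mult)
  qed
  moreover have "inj_on F D" by (auto simp: F_def inj_on_def)
  moreover have "finite D" using fin by (auto simp: D_def)
  moreover have "real (card D) = (\<Sum>(u, v)\<in>A. real u) * real (n * U)"
    using fin by (simp add: D_def case_prod_unfold sum_distrib_right)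
  moreover have "real U ^ 3 / 64 * real (n * U) \<le> (\<Sum>(u, v)\<in>A. real u) * real (n * U)"
    using sum_coprime_pairs_ge[of U] by (intro mult_right_mono) (simp_all add: A_def)
  ultimately show ?thesis
    by (simp add: card_image eval_nat_numeral algebra_simps)
qed

text \<open>Pigeonhole: if every line carried a mark in its own direction, choosing one mark per
  line would inject the lines into \<open>B\<close>, against the lower bound on their
  number.\<close>

lemma unmarked_grid_line:
  assumes "finite B" "real (card B) < real n * real U ^ 4 / 64"
  obtains p d where "(p, d) \<in> grid_lines n U" "\<And>j. (line_point p d j, d) \<notin> B"
proof -
  have "\<exists>(p, d)\<in>grid_lines n U. \<forall>j. (line_point p d j, d) \<notin> B"
  proof (rule ccontr)
    assume "\<not> ?thesis"
    then have "\<forall>l\<in>grid_lines n U. \<exists>j. (line_point (fst l) (snd l) j, snd l) \<in> B"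
      by force
    then obtain j where j: "\<And>l. l \<in> grid_lines n U \<Longrightarrow>
        (line_point (fst l) (snd l) (j l), snd l) \<in> B"
      by metis
    \<comment> \<open>A mark records its direction, so two lines sharing a mark are parallel;
      parallel lines of the family that meet have the same starting point.\<close>
    have "inj_on (\<lambda>l. (line_point (fst l) (snd l) (j l), snd l)) (grid_lines n U)"
    proof (rule inj_onI)
      fix k l assume kl: "k \<in> grid_lines n U" "l \<in> grid_lines n U"
        and eq: "(line_point (fst k) (snd k) (j k), snd k) = (line_point (fst l) (snd l) (j l), snd l)"
      then have "fst k = fst l"
        using grid_lines_disjoint[of "fst k" "snd k" n U "fst l" "j k" "j l"]
        by (metis prod.collapse prod.inject)
      with eq show "k = l" by (simp add: prod_eq_iff)
    qed
    then have "card (grid_lines n U) \<le> card B"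
      using j assms(1) by (intro card_inj_on_le) auto
    then show False using card_grid_lines[of n U] assms(2) by linarith
  qed
  then show ?thesis using that by blast
qed

section \<open>The non-adaptive strategy\<close>

text \<open>The square of side \<open>L\<close> is filled column by column. Later indices go to the
  column with first coordinate -1, outside the square, so that fresh points never run out.\<close>

definition grid_enum :: "nat \<Rightarrow> nat \<Rightarrow> point" where
  "grid_enum L k = (if k < L * L then (int (k div L), int (k mod L)) else (-1, int k))"

lemma inj_grid_enum: "inj (grid_enum L)"
proof (rule injI)
  fix i j assume "grid_enum L i = grid_enum L j"
  then show "i = j"
    by (auto simp: grid_enum_def split: if_splits) (metis div_mod_decomp)
qed

lemma grid_enum_covers: "{0..<int L} \<times> {0..<int L} \<subseteq> grid_enum L ` {..<L * L}"
proof clarify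
  fix x y assume "x \<in> {0..<int L}" "y \<in> {0..<int L}"
  then have *: "nat x < L" "nat y < L" "0 \<le> x" "0 \<le> y" by auto
  then have "nat x * L + nat y < (nat x + 1) * L" by simp
  also have "\<dots> \<le> L * L" using * by (intro mult_right_mono) auto
  finally have "nat x * L + nat y < L * L" .
  moreover from this have "(x, y) = grid_enum L (nat x * L + nat y)"
    using * by (simp add: grid_enum_def)
  ultimately show "(x, y) \<in> grid_enum L ` {..<L * L}" by blast
qed

text \<open>In timestep \<open>t\<close> the history has length \<open>t - 1\<close>, so the indices
  form the next block of \<open>m t\<close> consecutive numbers. Only the length of the history
  enters, which makes the strategy non-adaptive.\<close>

definition enum_strategy :: "(nat \<Rightarrow> nat) \<Rightarrow> (nat \<Rightarrow> point) \<Rightarrow> maker_strategy" where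
  "enum_strategy m e hs = e ` {sum m {1..length hs}..<sum m {1..length hs + 1}}"

lemma maker_move_enum_strategy:
  "t \<ge> 1 \<Longrightarrow> maker_move (enum_strategy m e) \<beta> t = e ` {sum m {1..<t}..<sum m {1..<Suc t}}"
  by (simp add: maker_move_def enum_strategy_def atLeastLessThanSuc_atLeastAtMost[symmetric])

lemma Union_maker_move_enum_strategy:
  "(\<Union>s\<in>{1..<t}. maker_move (enum_strategy m e) \<beta> s) = e ` {..<sum m {1..<t}}"
proof (induction t)
  case (Suc t)
  show ?case
  proof (cases "t \<ge> 1")
    case True
    then have "{1..<Suc t} = insert t {1..<t}" by auto
    then have "(\<Union>s\<in>{1..<Suc t}. maker_move (enum_strategy m e) \<beta> s) =
        e ` ({..<sum m {1..<t}} \<union> {sum m {1..<t}..<sum m {1..<Suc t}})"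
      using Suc True by (simp only: UN_insert image_Un maker_move_enum_strategy) blast
    also have "{..<sum m {1..<t}} \<union> {sum m {1..<t}..<sum m {1..<Suc t}} = {..<sum m {1..<Suc t}}"
      using True by (intro ivl_disj_un_one) simp
    finally show ?thesis .
  qed simp
qed simp

text \<open>Consecutive index blocks are disjoint, and injectivity of \<open>e\<close> carries both
  their sizes and their disjointness over to points.\<close>

lemma legal_enum_strategy:
  assumes "inj e"
  shows "legal_strategy m b (enum_strategy m e)"
  unfolding legal_strategy_def
proof (intro allI impI)
  fix \<beta> and t :: nat assume t: "1 \<le> t"
  have "card (e ` {sum m {1..<t}..<sum m {1..<Suc t}}) = m t"
    using t by (subst card_image) (auto intro: inj_on_subset[OF assms])
  moreover have "e ` {sum m {1..<t}..<sum m {1..<Suc t}} \<inter> e ` {..<sum m {1..<t}} = {}"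
    by (subst image_Int[OF assms, symmetric]) auto
  ultimately show "finite (maker_move (enum_strategy m e) \<beta> t) \<and>
      card (maker_move (enum_strategy m e) \<beta> t) = m t \<and>
      maker_move (enum_strategy m e) \<beta> t \<inter>
        (\<Union>s\<in>{1..<t}. maker_move (enum_strategy m e) \<beta> s) = {}"
    using t by (simp only: Union_maker_move_enum_strategy maker_move_enum_strategy) simp
qed

text \<open>By his move in timestep \<open>T\<close> Maker owns the whole square of side
  \<open>2 * n * U\<close>. Breaker has then moved only in timesteps before \<open>T\<close>, too
  few marks to spoil every line of the family.\<close>

lemma maker_guarantees_grid:
  assumes "T \<ge> 1" "(2 * n * U)\<^sup>2 \<le> sum m {1..T}"
    and few: "real (sum b {1..<T}) < real n * real U ^ 4 / 64"
  shows "maker_guarantees m b n T"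
proof -
  define L where "L = 2 * n * U"
  define \<sigma> where "\<sigma> = enum_strategy m (grid_enum L)"
  have "forms_segment n \<sigma> \<beta> T" if \<beta>: "breaker_play b \<beta>" for \<beta>
  proof -
    define B where "B = (\<Union>s\<in>{1..<T}. \<beta> s)"
    have "finite B" using \<beta> by (auto simp: B_def breaker_play_def)
    have "card B \<le> (\<Sum>s\<in>{1..<T}. card (\<beta> s))" unfolding B_def by (rule card_UN_le) simp
    also have "\<dots> = sum b {1..<T}" using \<beta> by (intro sum.cong) (auto simp: breaker_play_def)
    finally have "real (card B) < real n * real U ^ 4 / 64" using few by linarith
    then obtain p d where pd: "(p, d) \<in> grid_lines n U"
      and free: "\<And>j. (line_point p d j, d) \<notin> B"
      using unmarked_grid_line[OF \<open>finite B\<close>] by metis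
    define S where "S = (\<lambda>k. line_point p d (int k)) ` {..<n}"
    have "S \<subseteq> {0..<int L} \<times> {0..<int L}"
      unfolding S_def L_def using grid_lines_in_grid[OF pd] by blast
    also have "\<dots> \<subseteq> grid_enum L ` {..<L * L}" by (rule grid_enum_covers)
    also have "\<dots> \<subseteq> grid_enum L ` {..<sum m {1..<Suc T}}"
      using assms(2) by (intro image_mono)
        (auto simp: L_def power2_eq_square atLeastLessThanSuc_atLeastAtMost)
    also have "\<dots> = (\<Union>s\<in>{1..T}. maker_move \<sigma> \<beta> s)"
      using Union_maker_move_enum_strategy[of m "grid_enum L" \<beta> "Suc T"]
      by (simp only: \<sigma>_def atLeastLessThanSuc_atLeastAtMost)
    finally have "S \<subseteq> (\<Union>s\<in>{1..T}. maker_move \<sigma> \<beta> s)" .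
    moreover have "card S = n" unfolding S_def
      by (subst card_image) (auto intro!: inj_onI dest: line_point_inj[OF grid_lines_direction[OF pd]])
    moreover have "finite S" "S \<subseteq> range (line_point p d)" by (auto simp: S_def)
    \<comment> \<open>The chosen line has no mark in its direction anywhere, in particular none
      between the first and last point of \<open>S\<close>.\<close>
    ultimately have "winning_segment n (\<Union>s\<in>{1..T}. maker_move \<sigma> \<beta> s) B S"
      unfolding winning_segment_def using free grid_lines_direction[OF pd] by blast
    then show ?thesis unfolding forms_segment_def B_def by blast
  qed
  moreover have "legal_strategy m b \<sigma>"
    unfolding \<sigma>_def by (intro legal_enum_strategy inj_grid_enum)
  ultimately show ?thesis unfolding maker_guarantees_def using \<open>T \<ge> 1\<close>
    by (meson atLeastAtMost_iff order_refl)
qed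

section \<open>Choice of the grid side\<close>

lemma nat_floor_bounds:
  fixes x :: real
  assumes "x \<ge> 1"
  shows "real (nat \<lfloor>x\<rfloor>) \<le> x" "x \<le> 2 * real (nat \<lfloor>x\<rfloor>)"
proof -
  have "\<lfloor>x\<rfloor> \<ge> 1" using assms by simp
  then have eq: "real (nat \<lfloor>x\<rfloor>) = of_int \<lfloor>x\<rfloor>" and "of_int \<lfloor>x\<rfloor> \<ge> (1::real)" by simp_all
  then show "real (nat \<lfloor>x\<rfloor>) \<le> x" "x \<le> 2 * real (nat \<lfloor>x\<rfloor>)"
    unfolding eq using floor_correct[of x] by linarith+
qed

text \<open>The largest \<open>U\<close> for which the square fits into \<open>N\<close> points is
  \<open>sqrt N / (2 * n)\<close> rounded down. The bound on \<open>n\<close> makes this quotient at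
  least 1, so rounding at most halves it and \<open>N^2\<close> is at most
  \<open>256 * n^4 * U^4\<close>. The constant 16384 is 256 times the 64 of the line count.\<close>

lemma maker_guarantees_if_few_marks:
  assumes "T \<ge> 1" "n \<ge> 1" and N: "4 * real n ^ 2 \<le> real (sum m {1..T})"
    and few: "16384 * real n ^ 3 * real (sum b {1..<T}) < real (sum m {1..T}) ^ 2"
  shows "maker_guarantees m b n T"
proof -
  define N where "N = real (sum m {1..T})"
  define x where "x = sqrt N / (2 * real n)"
  define U where "U = nat \<lfloor>x\<rfloor>"
  have n: "real n > 0" using assms by simp
  have "2 * real n \<le> sqrt N" by (rule real_le_rsqrt) (use N in \<open>simp add: N_def power_mult_distrib\<close>)
  then have x: "x \<ge> 1" using n by (simp add: x_def)
  have N0: "N \<ge> 0" unfolding N_def by (rule of_nat_0_le_iff)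
  have U: "real U \<le> x" "x \<le> 2 * real U" using nat_floor_bounds[OF x] by (simp_all add: U_def)
  have xN: "2 * real n * x = sqrt N" using n by (simp add: x_def)
  have "(2 * real n * real U) ^ 2 \<le> (sqrt N) ^ 2"
    unfolding xN[symmetric] using U by (intro power_mono mult_left_mono) auto
  then have "real ((2 * n * U) ^ 2) \<le> real (sum m {1..T})" using N0 by (simp add: N_def)
  then have 1: "(2 * n * U) ^ 2 \<le> sum m {1..T}" by (simp only: of_nat_le_iff)
  have "(2 * real n * x) ^ 4 = N ^ 2" unfolding xN
    using N0 by (simp add: power4_eq_xxxx power2_eq_square)
  moreover have "x ^ 4 \<le> (2 * real U) ^ 4" using U x by (intro power_mono) auto
  then have "(2 * real n) ^ 4 * x ^ 4 \<le> (2 * real n) ^ 4 * (2 * real U) ^ 4"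
    by (intro mult_left_mono) auto
  ultimately have "N ^ 2 \<le> 256 * real n ^ 4 * real U ^ 4" by (simp add: power_mult_distrib)
  with few have "16384 * real n ^ 3 * real (sum b {1..<T}) < 256 * real n ^ 4 * real U ^ 4"
    unfolding N_def by (rule less_le_trans)
  also have "\<dots> = 16384 * real n ^ 3 * (real n * real U ^ 4 / 64)"
    by (simp add: eval_nat_numeral)
  finally have "real (sum b {1..<T}) < real n * real U ^ 4 / 64"
    using n by (subst (asm) mult_less_cancel_left_pos) auto
  with 1 show ?thesis by (intro maker_guarantees_grid[OF \<open>T \<ge> 1\<close>])
qed

section \<open>Power growth\<close>

text \<open>The later half of the timesteps suffices: there \<open>s\<close> is at least
  \<open>T/2\<close>, so \<open>s powr \<alpha>\<close> is at least half of
  \<open>T powr \<alpha>\<close>, and rounding down costs another factor of at most 2.\<close>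

lemma sum_floor_powr_ge:
  assumes "0 \<le> \<alpha>" "\<alpha> \<le> 1" "T \<ge> 1"
  shows "real T powr (1 + \<alpha>) / 8 \<le> real (\<Sum>s=1..T. nat \<lfloor>real s powr \<alpha>\<rfloor>)"
proof -
  have pt: "real T powr \<alpha> / 4 \<le> real (nat \<lfloor>real s powr \<alpha>\<rfloor>)"
    if s: "s \<in> {T - T div 2..T}" "s \<ge> 1" for s
  proof -
    have "real T powr \<alpha> \<le> (2 * real s) powr \<alpha>"
      using s assms by (intro powr_mono2) auto
    also have "\<dots> = 2 powr \<alpha> * real s powr \<alpha>" by (simp add: powr_mult)
    also have "\<dots> \<le> 2 powr 1 * real s powr \<alpha>" using assms by (intro mult_right_mono powr_mono) auto
    finally have "real T powr \<alpha> \<le> 2 * real s powr \<alpha>" by simp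
    moreover have "real s powr \<alpha> \<ge> 1" using s assms by (intro ge_one_powr_ge_zero) auto
    then have "real s powr \<alpha> \<le> 2 * real (nat \<lfloor>real s powr \<alpha>\<rfloor>)"
      by (rule nat_floor_bounds)
    ultimately show ?thesis by linarith
  qed
  have "T - T div 2 \<ge> 1" using assms by simp
  then have sub: "{T - T div 2..T} \<subseteq> {1..T}" by auto
  \<comment> \<open>The interval from \<open>T - T div 2\<close> to \<open>T\<close> has
    \<open>T div 2 + 1\<close> elements, at least \<open>T/2\<close> for either parity.\<close>
  have "real T \<le> 2 * real (T div 2 + 1)"
    using of_nat_mono[of T "2 * (T div 2 + 1)", where ?'a = real] by simp
  then have "real T / 2 * (real T powr \<alpha> / 4) \<le> real (T div 2 + 1) * (real T powr \<alpha> / 4)"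
    by (intro mult_right_mono) auto
  also have "\<dots> = (\<Sum>s\<in>{T - T div 2..T}. real T powr \<alpha> / 4)"
    using assms by simp
  also have "\<dots> \<le> (\<Sum>s\<in>{T - T div 2..T}. real (nat \<lfloor>real s powr \<alpha>\<rfloor>))"
    using sub by (intro sum_mono pt) auto
  also have "\<dots> \<le> (\<Sum>s=1..T. real (nat \<lfloor>real s powr \<alpha>\<rfloor>))"
    using sub by (intro sum_mono2) auto
  finally show ?thesis using assms by (simp add: powr_add)
qed

text \<open>With \<open>X = T powr \<alpha>\<close> and \<open>Y = T powr (1 - \<alpha>)\<close>,
  Maker has at least \<open>X^2 * Y / 8\<close> points, \<open>n\<close> is at most
  \<open>K * X\<close>, and Breaker has at most \<open>c * X * Y^2\<close> marks. Both sides of the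
  required inequality are then multiples of \<open>X^4 * Y^2\<close>, and a small \<open>c\<close>
  decides it.\<close>

lemma eventually_maker_guarantees:
  fixes m b :: "nat \<Rightarrow> nat"
  assumes \<alpha>: "0 \<le> \<alpha>" "\<alpha> < 1" and "mono b"
    and m: "\<And>t. m t = nat \<lfloor>real t powr \<alpha>\<rfloor>"
    and b: "(\<lambda>t. real (b t)) \<in> o(\<lambda>t. real t powr (1 - \<alpha>))"
    and K: "K > 0"
  shows "\<forall>\<^sub>F T in sequentially. \<forall>n\<ge>1. real n \<le> K * real T powr \<alpha> \<longrightarrow> maker_guarantees m b n T"
proof -
  \<comment> \<open>As 2097152 is 128 times 16384, the product \<open>16384 * K^3 * c\<close> equals
    1/128, below the factor 1/64 in the lower bound for \<open>N^2\<close>.\<close>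
  define c where "c = 1 / (2097152 * K ^ 3)"
  have c: "c > 0" using K by (simp add: c_def)
  have "\<forall>\<^sub>F T in sequentially. norm (real (b T)) \<le> c * norm (real T powr (1 - \<alpha>))"
    using landau_o.smallD[OF b c] .
  moreover have "filterlim (\<lambda>T. real T powr (1 - \<alpha>)) at_top sequentially"
    using \<alpha> by real_asymp
  \<comment> \<open>Here \<alpha> < 1 enters: \<open>Y\<close> is unbounded, and
    \<open>32 * K^2 \<le> Y\<close> gives \<open>4 * n^2 \<le> X^2 * Y / 8\<close>, so the grid side
    can be chosen positive.\<close>
  then have "\<forall>\<^sub>F T in sequentially. 32 * K ^ 2 \<le> real T powr (1 - \<alpha>)"
    by (simp add: filterlim_at_top)
  ultimately show ?thesis
    using eventually_ge_at_top[of 1]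
  proof eventually_elim
    case (elim T)
    define X where "X = real T powr \<alpha>"
    define Y where "Y = real T powr (1 - \<alpha>)"
    define N where "N = real (sum m {1..T})"
    have T: "real T > 0" using elim by simp
    have X: "X > 0" "Y > 0" using T by (simp_all add: X_def Y_def)
    have XY: "X * Y = real T" using T by (simp add: X_def Y_def flip: powr_add)
    have "real T powr (1 + \<alpha>) = X ^ 2 * Y"
      using T XY by (simp add: powr_add power2_eq_square mult.assoc) (simp add: X_def mult.commute)
    then have N: "X ^ 2 * Y / 8 \<le> N"
      using sum_floor_powr_ge[of \<alpha> T] \<alpha> elim by (simp add: N_def m)
    have "sum b {1..<T} \<le> (\<Sum>s\<in>{1..<T}. b T)"
      using \<open>mono b\<close> by (intro sum_mono) (simp add: monoD)
    also have "\<dots> \<le> T * b T" by simp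
    finally have "real (sum b {1..<T}) \<le> real (T * b T)" by (simp only: of_nat_le_iff)
    also have "\<dots> = X * Y * real (b T)" by (simp add: XY)
    also have "\<dots> \<le> X * Y * (c * Y)"
      using elim X by (intro mult_left_mono) (simp_all add: Y_def)
    finally have B: "real (sum b {1..<T}) \<le> X * Y * (c * Y)" .
    show ?case
    proof (intro allI impI)
      fix n :: nat assume n: "1 \<le> n" "real n \<le> K * real T powr \<alpha>"
      then have nX: "real n \<le> K * X" by (simp add: X_def)
      have "4 * real n ^ 2 \<le> 4 * (K * X) ^ 2" using nX by (intro mult_left_mono power_mono) auto
      also have "\<dots> = 32 * K ^ 2 * X ^ 2 / 8" by (simp add: power_mult_distrib)
      also have "\<dots> \<le> Y * X ^ 2 / 8"
        using elim by (intro divide_right_mono mult_right_mono) (simp_all add: Y_def)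
      finally have 1: "4 * real n ^ 2 \<le> N" using N by (simp add: mult.commute)
      have "16384 * real n ^ 3 * real (sum b {1..<T}) \<le> 16384 * (K * X) ^ 3 * (X * Y * (c * Y))"
        using nX B K X by (intro mult_mono power_mono) (auto simp: sum_nonneg)
      also have "\<dots> = (X ^ 2 * Y) ^ 2 / 128"
        using K by (simp add: c_def power_mult_distrib) (simp add: eval_nat_numeral)
      also have "\<dots> < (X ^ 2 * Y / 8) ^ 2" using X by (simp add: power_divide)
      also have "\<dots> \<le> N ^ 2" using N X by (intro power_mono) auto
      finally have 2: "16384 * real n ^ 3 * real (sum b {1..<T}) < N ^ 2" .
      from 1 2 show "maker_guarantees m b n T"
        using n elim by (intro maker_guarantees_if_few_marks) (simp_all add: N_def)
    qed
  qed
qed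

section \<open>From guarantees to the value of \<open>tau\<close>\<close>

lemma tau_finite_le:
  assumes "maker_guarantees m b n T"
  obtains T' where "tau m b n = enat T'" "T' \<le> T"
proof -
  have "tau m b n \<le> enat T"
    unfolding tau_def using assms by (intro INF_lower) simp
  then show ?thesis using that by (metis enat_ile enat_ord_simps(1))
qed

theorem theorem4:
  fixes \<alpha> :: real and m b :: "nat \<Rightarrow> nat"
  assumes "\<alpha> < 1"
    and "mono m" and "mono b"
    and "\<And>t. m t = nat \<lfloor>real t powr \<alpha>\<rfloor>"
    and "(\<lambda>t. real (b t)) \<in> o(\<lambda>t. real t powr (1 - \<alpha>))"
  shows "\<exists>\<epsilon>>0. \<forall>\<^sub>F n in sequentially.
           \<exists>T. tau m b n = enat T \<and> real (m T) < (1 - \<epsilon>) * real n"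
proof -
  note m = assms(4)
  \<comment> \<open>Monotonicity of \<open>m\<close> forces \<alpha> to be nonnegative:
    \<open>m 1 = 1\<close>, whereas a negative \<alpha> would give \<open>m 2 = 0\<close>.\<close>
  have "m 1 \<le> m 2" using \<open>mono m\<close> by (simp add: monoD)
  then have "1 \<le> \<lfloor>2 powr \<alpha>\<rfloor>" by (simp add: m le_nat_iff)
  then have "2 powr 0 \<le> 2 powr \<alpha>" by simp
  then have \<alpha>: "0 \<le> \<alpha>" by (subst (asm) powr_le_cancel_iff) auto
  note ev = eventually_maker_guarantees[OF \<alpha> assms(1,3) m assms(5)]
  have "\<forall>\<^sub>F n in sequentially. \<exists>T. maker_guarantees m b n T \<and> real (m T) < real n / 2"
  proof (cases "\<alpha> = 0")
    \<comment> \<open>For \<alpha> = 0 Maker claims one point per timestep, so any sufficiently late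
      \<open>T\<close> serves for a given \<open>n\<close>, with \<open>K = n\<close>;
      \<open>n \<ge> 3\<close> makes 1 smaller than \<open>n/2\<close>.\<close>
    case True
    show ?thesis
      using eventually_ge_at_top[of 3]
    proof eventually_elim
      case (elim n)
      then have "\<forall>\<^sub>F T in sequentially. 1 \<le> T \<and> maker_guarantees m b n T"
        using ev[of "real n"] eventually_ge_at_top[of 1]
        by (auto elim!: eventually_elim2 simp: True)
      then obtain T where "1 \<le> T" "maker_guarantees m b n T"
        by (auto dest: eventually_happens)
      then show ?case using elim by (intro exI[of _ T]) (simp add: m True)
    qed
  next
    case False
    with \<alpha> have \<alpha>0: "\<alpha> > 0" by simp
    \<comment> \<open>This \<open>T n\<close> is the rounded time at which
      \<open>t powr \<alpha>\<close> reaches \<open>n/4\<close>, so \<open>m (T n)\<close> is at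
      most \<open>n/4\<close>. Rounding costs at most a factor 2 in time, hence at most 2 in the
      power, which gives \<open>n \<le> 8 * T n powr \<alpha>\<close> and explains the choice
      \<open>K = 8\<close>.\<close>
    define T where "T n = nat \<lfloor>(real n / 4) powr (1 / \<alpha>)\<rfloor>" for n :: nat
    have lim: "filterlim T at_top sequentially"
      unfolding T_def using \<alpha>0 by real_asymp
    have "\<forall>\<^sub>F n in sequentially. \<forall>k\<ge>1. real k \<le> 8 * real (T n) powr \<alpha> \<longrightarrow>
        maker_guarantees m b k (T n)"
      using ev[of 8] lim by (auto simp: filterlim_iff)
    moreover have "\<forall>\<^sub>F n in sequentially. T n \<ge> 1"
      using lim by (simp add: filterlim_at_top)
    ultimately show ?thesis
      using eventually_ge_at_top[of 1]
    proof eventually_elim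
      case (elim n)
      define x where "x = (real n / 4) powr (1 / \<alpha>)"
      have x: "x powr \<alpha> = real n / 4" "x \<ge> 0" using \<alpha>0 by (simp_all add: x_def powr_powr)
      have Tn: "real (T n) \<le> x" "x \<le> 2 * real (T n)"
        using elim(2) x(2) unfolding T_def x_def[symmetric] by linarith+
      have "x powr \<alpha> \<le> (2 * real (T n)) powr \<alpha>" using Tn x \<alpha> by (intro powr_mono2) auto
      also have "\<dots> = 2 powr \<alpha> * real (T n) powr \<alpha>" by (simp add: powr_mult)
      also have "\<dots> \<le> 2 powr 1 * real (T n) powr \<alpha>"
        using assms(1) by (intro mult_right_mono powr_mono) auto
      finally have "real n \<le> 8 * real (T n) powr \<alpha>" using x by simp
      then have "maker_guarantees m b n (T n)" using elim by blast
      moreover have "real (T n) powr \<alpha> \<le> x powr \<alpha>" using Tn \<alpha> by (intro powr_mono2) auto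
      then have "real (m (T n)) \<le> real n / 4"
        unfolding m x(1) using powr_ge_zero[of "real (T n)" \<alpha>] by linarith
      ultimately show ?case using elim(3) by (intro exI[of _ "T n"]) simp
    qed
  qed
  then have "\<forall>\<^sub>F n in sequentially. \<exists>T. tau m b n = enat T \<and> real (m T) < (1 - 1/2) * real n"
  proof eventually_elim
    case (elim n)
    then obtain T where T: "maker_guarantees m b n T" "real (m T) < real n / 2" by blast
    from T(1) obtain T' where T': "tau m b n = enat T'" "T' \<le> T" by (rule tau_finite_le)
    \<comment> \<open>The value of \<open>tau\<close> may be earlier than the time of the explicit
      strategy; monotonicity of \<open>m\<close> carries the bound down to it.\<close>
    have "m T' \<le> m T" using \<open>mono m\<close> T'(2) by (rule monoD)
    with T T' show ?case by auto
  qed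
  then show ?thesis by (intro exI[of _ "1/2"]) simp
qed

end
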